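(* Let $S$ be a semiring and let $B$ be an amount $S$-semialgebra with amount function $A: B \to \mathrm{Id}(S)$, $f \mapsto A_f$. Then $A_f A_g \subseteq \sqrt{A_{fg}}$ for all $f,g\in B$.
   Context: A semiring is a set $S$ with operations $+,\cdot$ such that $(S,+,0)$ and $(S,\cdot,1)$ are commutative monoids with $1\neq 0$, multiplication distributes over addition, and $s\cdot 0=0$ for all $s$. An ideal of $S$ is a nonempty subset closed under addition and under multiplication by elements of $S$; $\mathrm{Id}(S)$ is the set of ideals of $S$. $IJ$ denotes the ideal of all finite sums of products $xy$ with $x\in I$, $y\in J$; $I^0=S$; $(s)$ is the ideal generated by $s$; $\sqrt{I}=\{s\in S: s^n\in I \text{ for some } n\ge 1\}$ (equivalently the intersection of the prime ideals containing $I$). An $S$-semialgebra is a semiring $B$ together with a semiring morphism $\gamma: S\to B$ (preserving $+,\cdot,0,1$); for $s\in S$, $f\in B$ write $sf=\gamma(s)f$. An amount function is a function $A: B\to \mathrm{Id}(S)$, $f\mapsto A_f$, such that for all $s\in S$, $f,g\in B$: (1) $A_0=(0)$ and $A_1=S$; (2) $A_f=(0)$ implies $f=0$; (3) $A_{sf}=sA_f$; (4) $A_{fg}\subseteq A_fA_g$. $B$ is an amount $S$-semialgebra if: (i) there is an amount function $A: B\to\mathrm{Id}(S)$ such that for all $f,g\in B$ there are non-negative integers $m,n$ with $A_f^mA_g^nA_{fg}=A_f^{m+1}A_g^{n+1}$; and (ii) there is a function $\epsilon:\mathrm{Id}(S)\to\mathrm{Id}(B)$, $I\mapsto I^{\epsilon}$,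 such that $A_f\subseteq I$ if and only if $f\in I^\epsilon$ (for all $f\in B$, $I\in \mathrm{Id}(S)$), and $I^{\epsilon}\cap S=I$ for all $I\in\mathrm{Id}(S)$ (where $I^\epsilon\cap S$ means $\gamma^{-1}(I^\epsilon)$). *)

theory Defs
  imports Main
begin

text \<open>
  The class \<open>comm_semiring_1\<close> has exactly the required semiring axioms, including \<open>0 \<noteq> 1\<close> and
  absorption by \<open>0\<close>. An \<open>S\<close>-semialgebra \<open>B\<close> is given by its structure morphism \<open>\<gamma>\<close>, with
  \<open>S\<close> and \<open>B\<close> rendered as the types \<open>'s\<close> and \<open>'b\<close>.
\<close>

definition is_ideal :: "'a::comm_semiring_1 set \<Rightarrow> bool" where
  "is_ideal I \<longleftrightarrow>
     I \<noteq> {} \<and> (\<forall>x\<in>I. \<forall>y\<in>I. x + y \<in> I) \<and> (\<forall>s. \<forall>x\<in>I. s * x \<in> I)"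

definition Ideals :: "'a::comm_semiring_1 set set" where
  "Ideals = {I. is_ideal I}"

definition principal_ideal :: "'a::comm_semiring_1 \<Rightarrow> 'a set" where
  "principal_ideal s = \<Inter>{I \<in> Ideals. s \<in> I}"

definition ideal_prod :: "'a::comm_semiring_1 set \<Rightarrow> 'a set \<Rightarrow> 'a set" where
  "ideal_prod I J =
     {\<Sum>k<n. x k * y k | (n::nat) x y. \<forall>k<n. x k \<in> I \<and> y k \<in> J}"

primrec ideal_pow :: "'a::comm_semiring_1 set \<Rightarrow> nat \<Rightarrow> 'a set" where
  "ideal_pow I 0 = UNIV"
| "ideal_pow I (Suc n) = ideal_prod I (ideal_pow I n)"

definition radical :: "'a::comm_semiring_1 set \<Rightarrow> 'a set" where
  "radical I = {s. \<exists>n\<ge>1. s ^ n \<in> I}"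

definition semiring_morphism :: "('s::comm_semiring_1 \<Rightarrow> 'b::comm_semiring_1) \<Rightarrow> bool" where
  "semiring_morphism \<gamma> \<longleftrightarrow>
     \<gamma> 0 = 0 \<and> \<gamma> 1 = 1 \<and>
     (\<forall>s t. \<gamma> (s + t) = \<gamma> s + \<gamma> t) \<and> (\<forall>s t. \<gamma> (s * t) = \<gamma> s * \<gamma> t)"

definition amount_function ::
    "('s::comm_semiring_1 \<Rightarrow> 'b::comm_semiring_1) \<Rightarrow> ('b \<Rightarrow> 's set) \<Rightarrow> bool" where
  "amount_function \<gamma> A \<longleftrightarrow>
     (\<forall>f. A f \<in> Ideals) \<and>
     A 0 = principal_ideal 0 \<and> A 1 = UNIV \<and>
     (\<forall>f. A f = principal_ideal 0 \<longrightarrow> f = 0) \<and>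
     (\<forall>s f. A (\<gamma> s * f) = (\<lambda>x. s * x) ` A f) \<and>
     (\<forall>f g. A (f * g) \<subseteq> ideal_prod (A f) (A g))"

definition amount_semialgebra ::
    "('s::comm_semiring_1 \<Rightarrow> 'b::comm_semiring_1) \<Rightarrow> ('b \<Rightarrow> 's set) \<Rightarrow> bool" where
  "amount_semialgebra \<gamma> A \<longleftrightarrow>
     semiring_morphism \<gamma> \<and>
     amount_function \<gamma> A \<and>
     (\<forall>f g. \<exists>m n.
        ideal_prod (ideal_prod (ideal_pow (A f) m) (ideal_pow (A g) n)) (A (f * g)) =
        ideal_prod (ideal_pow (A f) (m + 1)) (ideal_pow (A g) (n + 1))) \<and>
     (\<exists>\<epsilon> :: 's set \<Rightarrow> 'b set.
        (\<forall>I\<in>Ideals. \<epsilon> I \<in> Ideals) \<and>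
        (\<forall>f. \<forall>I\<in>Ideals. A f \<subseteq> I \<longleftrightarrow> f \<in> \<epsilon> I) \<and>
        (\<forall>I\<in>Ideals. \<gamma> -` \<epsilon> I = I))"

end

theory Submission
  imports Defs
begin

text \<open>
  An element \<open>z\<close> of \<open>A\<^sub>f A\<^sub>g\<close> lies in both \<open>A\<^sub>f\<close> and \<open>A\<^sub>g\<close>, so \<open>z^(m + 1) z^(n + 1)\<close> lies in
  the product of \<open>A\<^sub>f^(m + 1)\<close> and \<open>A\<^sub>g^(n + 1)\<close>. For suitable \<open>m\<close> and \<open>n\<close> this product has
  \<open>A\<^sub>f\<^sub>g\<close> as a factor.
\<close>

lemma is_ideal_sum:
  fixes n :: nat
  assumes "is_ideal I" "\<And>k. k < n \<Longrightarrow> h k \<in> I"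
  shows "(\<Sum>k<n. h k) \<in> I"
  using assms(2)
proof (induction n)
  case 0
  \<comment> \<open>The empty sum requires \<open>0\<close> in \<open>I\<close>. Ideals are only
    assumed nonempty, so \<open>0\<close> is produced by absorption as \<open>0 * x\<close>.\<close>
  obtain x where "x \<in> I" using assms(1) by (auto simp: is_ideal_def)
  then have "0 * x \<in> I" using assms(1) unfolding is_ideal_def by blast
  then show ?case by simp
next
  case (Suc n)
  then show ?case using assms(1) by (simp add: is_ideal_def)
qed

text \<open>Absorption in \<open>J\<close> puts each term \<open>x k * y k\<close> into
  \<open>J\<close>, whatever set \<open>I\<close> is. The main proof can thus take for
  \<open>I\<close> a product of ideal powers that is never shown to be an ideal.\<close>

lemma ideal_prod_subset_right:
  assumes "is_ideal J"
  shows "ideal_prod I J \<subseteq> J"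
proof -
  have "(\<Sum>k<n. x k * y k) \<in> J" if "\<forall>k<n. x k \<in> I \<and> y k \<in> J" for n :: nat and x y
    using that assms by (intro is_ideal_sum) (auto simp: is_ideal_def)
  then show ?thesis by (auto simp: ideal_prod_def)
qed

lemma ideal_prod_commute: "ideal_prod I J = ideal_prod J I"
proof -
  have "ideal_prod K L \<subseteq> ideal_prod L K" for K L :: "'a set"
  proof
    fix z assume "z \<in> ideal_prod K L"
    then obtain n :: nat and x y where "z = (\<Sum>k<n. x k * y k)" "\<forall>k<n. x k \<in> K \<and> y k \<in> L"
      unfolding ideal_prod_def by blast
    then have "z = (\<Sum>k<n. y k * x k)" "\<forall>k<n. y k \<in> L \<and> x k \<in> K"
      by (simp_all add: mult.commute)
    then show "z \<in> ideal_prod L K" unfolding ideal_prod_def by blast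
  qed
  then show ?thesis by blast
qed

lemma ideal_prod_subset_left: "is_ideal I \<Longrightarrow> ideal_prod I J \<subseteq> I"
  by (subst ideal_prod_commute) (rule ideal_prod_subset_right)

lemma mult_mem_ideal_prod:
  assumes "x \<in> I" "y \<in> J"
  shows "x * y \<in> ideal_prod I J"
proof -
  have "x * y = (\<Sum>k<(1::nat). x * y)" by simp
  then show ?thesis
    using assms unfolding ideal_prod_def mem_Collect_eq
    by (intro exI[of _ 1] exI[of _ "\<lambda>_. x"] exI[of _ "\<lambda>_. y"]) simp
qed

text \<open>The convention that the zeroth power is the whole semiring settles the base case; each
  further factor \<open>x\<close> is one use of \<open>mult_mem_ideal_prod\<close>.\<close>

lemma power_mem_ideal_pow: "x \<in> I \<Longrightarrow> x ^ n \<in> ideal_pow I n"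
  by (induction n) (simp_all add: mult_mem_ideal_prod)

theorem theorem2p13:
  fixes \<gamma> :: "'s::comm_semiring_1 \<Rightarrow> 'b::comm_semiring_1"
    and A :: "'b \<Rightarrow> 's set"
  assumes "amount_semialgebra \<gamma> A"
  shows "\<forall>f g. ideal_prod (A f) (A g) \<subseteq> radical (A (f * g))"
proof (intro allI subsetI)
  fix f g z
  assume z: "z \<in> ideal_prod (A f) (A g)"
  have ideal: "is_ideal (A h)" for h
    using assms by (simp add: amount_semialgebra_def amount_function_def Ideals_def)
  obtain m n where mn:
    "ideal_prod (ideal_prod (ideal_pow (A f) m) (ideal_pow (A g) n)) (A (f * g)) =
     ideal_prod (ideal_pow (A f) (m + 1)) (ideal_pow (A g) (n + 1))"
    \<comment> \<open>The chain of projections selects the amount equation, the third conjunct of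
      the definition.\<close>
    using assms[unfolded amount_semialgebra_def, THEN conjunct2, THEN conjunct2, THEN conjunct1]
    by (elim allE[of _ f] allE[of _ g] exE)
  have "z \<in> A f"
    by (rule subsetD[OF ideal_prod_subset_left[OF ideal] z])
  moreover have "z \<in> A g"
    by (rule subsetD[OF ideal_prod_subset_right[OF ideal] z])
  ultimately have "z ^ (m + 1) * z ^ (n + 1)
      \<in> ideal_prod (ideal_pow (A f) (m + 1)) (ideal_pow (A g) (n + 1))"
    by (intro mult_mem_ideal_prod power_mem_ideal_pow)
  then have "z ^ (m + 1) * z ^ (n + 1) \<in> A (f * g)"
    unfolding mn[symmetric] by (rule subsetD[OF ideal_prod_subset_right[OF ideal]])
  then have "z ^ ((m + 1) + (n + 1)) \<in> A (f * g)"
    by (simp only: power_add[of z "m + 1" "n + 1"])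
  \<comment> \<open>\<open>radical\<close> demands a positive exponent; this one is at least 2 even
    when \<open>m\<close> and \<open>n\<close> vanish.\<close>
  moreover have "(m + 1) + (n + 1) \<ge> 1" by simp
  ultimately show "z \<in> radical (A (f * g))"
    unfolding radical_def by blast
qed

end
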